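(* Let $G$ be a finite, simple, connected cactus graph, i.e. every edge of $G$ belongs to at most one cycle of $G$. Then $\dim(G)\le c(G)+Z(G)$.
   Context: $\dim(G)$ is the metric dimension: the minimum size of a set $S\subseteq V(G)$ such that for every two distinct vertices $u,v$ there is $s\in S$ with $d(s,u)\neq d(s,v)$ ($d$ the shortest-path distance). $Z(G)$ is the zero forcing number: the minimum size of a set of initially black vertices such that repeatedly applying the rule "if a black vertex has exactly one white neighbor, that neighbor becomes black" eventually makes all vertices black. $c(G)=|E(G)|-|V(G)|+1$ is the cycle rank. *)

theory Defs
  imports Main
begin

text \<open>
  A graph is given by a vertex set \<open>V\<close> and a set \<open>E\<close> of undirected edges, each edge being
  the two-element set of its endpoints.
\<close>

definition finite_simple_graph :: "'a set \<Rightarrow> 'a set set \<Rightarrow> bool" where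
  "finite_simple_graph V E \<longleftrightarrow> finite V \<and> (\<forall>e\<in>E. e \<subseteq> V \<and> card e = 2)"

definition is_path :: "'a set \<Rightarrow> 'a set set \<Rightarrow> 'a \<Rightarrow> 'a list \<Rightarrow> 'a \<Rightarrow> bool" where
  "is_path V E u p v \<longleftrightarrow>
     p \<noteq> [] \<and> set p \<subseteq> V \<and> distinct p \<and> hd p = u \<and> last p = v \<and>
     successively (\<lambda>x y. {x, y} \<in> E) p"

definition connected_graph :: "'a set \<Rightarrow> 'a set set \<Rightarrow> bool" where
  "connected_graph V E \<longleftrightarrow> V \<noteq> {} \<and> (\<forall>u\<in>V. \<forall>v\<in>V. \<exists>p. is_path V E u p v)"

text \<open>
  The length of a path is its number of edges. The value is only meaningful if a path from
  \<open>u\<close> to \<open>v\<close> exists.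
\<close>

definition graph_dist :: "'a set \<Rightarrow> 'a set set \<Rightarrow> 'a \<Rightarrow> 'a \<Rightarrow> nat" where
  "graph_dist V E u v = (LEAST n. \<exists>p. is_path V E u p v \<and> n = length p - 1)"

definition cycle_edges :: "'a list \<Rightarrow> 'a set set" where
  "cycle_edges p = {{p ! i, p ! (Suc i mod length p)} | i. i < length p}"

definition is_cycle :: "'a set \<Rightarrow> 'a set set \<Rightarrow> 'a list \<Rightarrow> bool" where
  "is_cycle V E p \<longleftrightarrow> 3 \<le> length p \<and> distinct p \<and> set p \<subseteq> V \<and> cycle_edges p \<subseteq> E"

text \<open>
  A cycle is a subgraph: the lists obtained from one another by rotation and reversal describe
  the same cycle. Cycles are therefore identified by their edge sets.
\<close>

definition cactus :: "'a set \<Rightarrow> 'a set set \<Rightarrow> bool" where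
  "cactus V E \<longleftrightarrow>
     (\<forall>e\<in>E. \<forall>p q. is_cycle V E p \<and> e \<in> cycle_edges p \<and> is_cycle V E q \<and> e \<in> cycle_edges q
        \<longrightarrow> cycle_edges p = cycle_edges q)"

definition resolving_set :: "'a set \<Rightarrow> 'a set set \<Rightarrow> 'a set \<Rightarrow> bool" where
  "resolving_set V E S \<longleftrightarrow>
     S \<subseteq> V \<and>
     (\<forall>u\<in>V. \<forall>v\<in>V. u \<noteq> v \<longrightarrow> (\<exists>s\<in>S. graph_dist V E s u \<noteq> graph_dist V E s v))"

definition metric_dimension :: "'a set \<Rightarrow> 'a set set \<Rightarrow> nat" where
  "metric_dimension V E = (LEAST k. \<exists>S. resolving_set V E S \<and> card S = k)"

text \<open>One application of the colour-change rule; \<open>B\<close> is the set of black vertices.\<close>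

definition force_step :: "'a set \<Rightarrow> 'a set set \<Rightarrow> 'a set \<Rightarrow> 'a set \<Rightarrow> bool" where
  "force_step V E B B' \<longleftrightarrow>
     (\<exists>u\<in>B. \<exists>v. {w \<in> V. {u, w} \<in> E \<and> w \<notin> B} = {v} \<and> B' = insert v B)"

definition zero_forcing_set :: "'a set \<Rightarrow> 'a set set \<Rightarrow> 'a set \<Rightarrow> bool" where
  "zero_forcing_set V E S \<longleftrightarrow> S \<subseteq> V \<and> (force_step V E)\<^sup>*\<^sup>* S V"

definition zero_forcing_number :: "'a set \<Rightarrow> 'a set set \<Rightarrow> nat" where
  "zero_forcing_number V E = (LEAST k. \<exists>S. zero_forcing_set V E S \<and> card S = k)"

definition cycle_rank :: "'a set \<Rightarrow> 'a set set \<Rightarrow> int" where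
  "cycle_rank V E = int (card E) - int (card V) + 1"

end

theory Submission
  imports Defs
begin

text \<open>
  Let \<open>S\<close> be a minimum zero forcing set. We add one vertex per cycle to \<open>S\<close> and obtain a
  resolving set; a cactus has at most \<open>c(G)\<close> cycles, since cycles are edge disjoint and
  deleting one edge from each keeps the graph connected.

  In a cactus the vertices of a cycle \<open>C\<close> lie in distinct components of \<open>G - E(C)\<close>, so
  \<open>G\<close> retracts onto \<open>C\<close> by sending a vertex to its gate. The gates of \<open>S\<close> on \<open>C\<close> cannot
  all be one vertex \<open>g\<close>, because \<open>g\<close> would then have to force two neighbours. Given two
  different gates \<open>x, y\<close>, there is \<open>t\<close> on \<open>C\<close> such that \<open>{x, y, t}\<close> doubly resolves the
  cycle: \<open>d(z, a) - d(z, b)\<close> is not constant on it for \<open>a \<noteq> b\<close>. These are the added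
  vertices.

  Suppose \<open>u \<noteq> v\<close> are not resolved. Then they have the same gate on every cycle, hence
  \<open>f(z) = d(z, u) - d(z, v)\<close> is constant on every cycle. As \<open>S\<close> misses the set \<open>f \<noteq> 0\<close>,
  the first force into it goes from some \<open>x\<close> to its only neighbour \<open>w\<close> in that set, say
  \<open>f(w) > 0\<close>. A neighbour \<open>x'\<close> of \<open>x\<close> closer to \<open>u\<close> then has \<open>f(x') = 0\<close>, so it is also
  closer to \<open>v\<close>. Geodesics from \<open>w\<close> and from \<open>x'\<close> to \<open>v\<close> avoid \<open>x\<close>, so \<open>x\<close> and \<open>w\<close> lie
  on a common cycle, on which \<open>f\<close> is not constant.
\<close>

section \<open>Distances in a cyclic order\<close>

text \<open>Integers are used because differences of distances, which can be negative, are
  compared.\<close>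

definition cyclic_dist :: "int \<Rightarrow> int \<Rightarrow> int \<Rightarrow> int" where
  "cyclic_dist n i j = min \<bar>i - j\<bar> (n - \<bar>i - j\<bar>)"

text \<open>The position of \<open>y\<close> seen from \<open>c\<close>: this is \<open>(y - c) mod n\<close> for \<open>0 \<le> y, c < n\<close>.\<close>

definition offset :: "int \<Rightarrow> int \<Rightarrow> int \<Rightarrow> int" where
  "offset n c y = (if c \<le> y then y - c else y - c + n)"

lemma offset_range:
  assumes "0 \<le> c" "c < n" "0 \<le> y" "y < n"
  shows "0 \<le> offset n c y" "offset n c y < n"
  using assms by (auto simp: offset_def)

lemma offset_inj:
  assumes "0 \<le> x" "x < n" "0 \<le> y" "y < n" "offset n c x = offset n c y"
  shows "x = y"
  using assms by (auto simp: offset_def split: if_splits)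

text \<open>Composing two rotations gives a rotation, so \<open>spread\<close> also applies to
  positions that are already measured from another base point.\<close>

lemma offset_offset:
  assumes "0 \<le> b" "b < n" "0 \<le> c" "c < n"
  obtains e where "0 \<le> e" "e < n" "\<And>y. 0 \<le> y \<Longrightarrow> y < n \<Longrightarrow> offset n e y = offset n c (offset n b y)"
proof
  show "0 \<le> (if b + c < n then b + c else b + c - n)" "(if b + c < n then b + c else b + c - n) < n"
    using assms by auto
  show "offset n (if b + c < n then b + c else b + c - n) y = offset n c (offset n b y)"
    if "0 \<le> y" "y < n" for y
    using assms that by (auto simp: offset_def)
qed

lemma cyclic_dist_eq_offset:
  assumes "0 \<le> b" "b < n" "0 \<le> y" "y < n"
  shows "cyclic_dist n y b = min (offset n b y) (n - offset n b y)"
  using assms by (auto simp: offset_def cyclic_dist_def min_def)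

lemma cyclic_dist_offset:
  assumes "0 \<le> b" "b < n" "0 \<le> y" "y < n" "0 \<le> a" "a < n"
  shows "cyclic_dist n y a = cyclic_dist n (offset n b y) (offset n b a)"
  using assms by (auto simp: offset_def cyclic_dist_def min_def)

text \<open>In the application, positions are measured from \<open>b\<close>, and \<alpha> is the
  position of \<open>a\<close>. As \<open>r\<close> runs once round from 0, the difference falls
  from \<alpha> to -\<alpha> with slope -2, stays there up to n/2, rises back with slope 2 and then
  stays at \<alpha>. So the extreme values fill arcs, and a value in between occurs at two positions
  at most.\<close>

lemma cyclic_dist_diff_cases:
  fixes n r \<alpha> :: int
  assumes "0 < \<alpha>" "2 * \<alpha> \<le> n" "0 \<le> r" "r < n"
    and "cyclic_dist n r \<alpha> - min r (n - r) = k"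
  shows "k = - \<alpha> \<and> \<alpha> \<le> r \<and> 2 * r \<le> n
     \<or> k = \<alpha> \<and> (r = 0 \<or> n + 2 * \<alpha> \<le> 2 * r)
     \<or> - \<alpha> < k \<and> k < \<alpha> \<and> (2 * r = \<alpha> - k \<or> 2 * r = n + \<alpha> + k)"
proof -
  consider "r \<le> \<alpha>" | "\<alpha> \<le> r" "2 * r \<le> n" | "n \<le> 2 * r" "2 * r \<le> n + 2 * \<alpha>" | "n + 2 * \<alpha> \<le> 2 * r"
    by linarith
  then show ?thesis
    by cases (use assms in \<open>auto simp: cyclic_dist_def min_def split: if_splits\<close>)
qed

text \<open>No arc with fewer than \<open>n / 2\<close> edges contains all of \<open>Y\<close>.\<close>

definition spread :: "int \<Rightarrow> int set \<Rightarrow> bool" where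
  "spread n Y \<longleftrightarrow> (\<forall>c. 0 \<le> c \<and> c < n \<longrightarrow> (\<exists>y\<in>Y. n \<le> 2 * offset n c y))"

text \<open>An extreme \<open>k\<close> puts the landmarks on an arc too short for
  \<open>spread\<close> or all at one position; any other \<open>k\<close> leaves two positions for
  three distinct landmarks. The bound on \<open>offset n b a\<close> makes the arc from
  \<open>b\<close> to \<open>a\<close> a shortest one.\<close>

lemma cyclic_dist_doubly_resolving:
  fixes n P Q R a b :: int
  assumes range: "{P, Q, R} \<subseteq> {0..<n}" and dist: "P \<noteq> Q" "Q \<noteq> R" "P \<noteq> R"
    and spread: "spread n {P, Q, R}"
    and a: "0 \<le> a" "a < n" and b: "0 \<le> b" "b < n" and "a \<noteq> b" "2 * offset n b a \<le> n"
    and eq: "\<And>y. y \<in> {P, Q, R} \<Longrightarrow> cyclic_dist n y a - cyclic_dist n y b = k"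
  shows False
proof -
  define \<alpha> where "\<alpha> = offset n b a"
  have \<alpha>: "0 < \<alpha>" "2 * \<alpha> \<le> n"
    using assms by (auto simp: \<alpha>_def offset_def)
  let ?r = "offset n b"
  have r: "0 \<le> ?r y" "?r y < n" if "y \<in> {P, Q, R}" for y
    using offset_range[OF b, of y] that range by auto
  have cases: "k = - \<alpha> \<and> \<alpha> \<le> ?r y \<and> 2 * ?r y \<le> n
     \<or> k = \<alpha> \<and> (?r y = 0 \<or> n + 2 * \<alpha> \<le> 2 * ?r y)
     \<or> - \<alpha> < k \<and> k < \<alpha> \<and> (2 * ?r y = \<alpha> - k \<or> 2 * ?r y = n + \<alpha> + k)"
    if y: "y \<in> {P, Q, R}" for y
  proof (rule cyclic_dist_diff_cases[OF \<alpha> r[OF y]])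
    have "0 \<le> y" "y < n" using y range by auto
    then show "cyclic_dist n (?r y) \<alpha> - min (?r y) (n - ?r y) = k"
      unfolding \<alpha>_def
      using eq[OF y] cyclic_dist_eq_offset[OF b, of y] cyclic_dist_offset[OF b _ _ a, of y] by simp
  qed
  have spread': "\<exists>y\<in>{P, Q, R}. n \<le> 2 * offset n c (?r y)" if c: "0 \<le> c" "c < n" for c
  proof -
    obtain e where "0 \<le> e" "e < n" and e: "\<And>y. 0 \<le> y \<Longrightarrow> y < n \<Longrightarrow> offset n e y = offset n c (?r y)"
      using offset_offset[OF b c] by blast
    then obtain y where y: "y \<in> {P, Q, R}" "n \<le> 2 * offset n e y"
      using spread unfolding spread_def by blast
    then show ?thesis using e[of y] range by force
  qed
  consider "k = - \<alpha>" | "k = \<alpha>" | "- \<alpha> < k" "k < \<alpha>" using cases[of P] by auto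
  then show False
  proof cases
    case 1
    \<comment> \<open>All landmarks lie between \<alpha> and n/2, hence at offset at most n/2 -
      \<alpha> from \<alpha>.\<close>
    have "\<exists>y\<in>{P, Q, R}. n \<le> 2 * offset n \<alpha> (?r y)" using \<alpha> by (intro spread') auto
    then obtain y where y: "y \<in> {P, Q, R}" "n \<le> 2 * offset n \<alpha> (?r y)" by blast
    then have "\<alpha> \<le> ?r y" "2 * ?r y \<le> n" using cases[of y] 1 \<alpha> by auto
    then show False using y \<alpha> by (simp add: offset_def)
  next
    case 2
    \<comment> \<open>Half of \<open>n\<close> is rounded up, so that n + 2\<alpha> \<le> 2r implies
      h + \<alpha> \<le> r. Seen from h + \<alpha>, every landmark, 0 included, has offset at most n
      - h - \<alpha>, which is less than n/2. If h + \<alpha> reaches \<open>n\<close>, only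
      position 0 is left.\<close>
    define h where "h = (n + 1) div 2"
    have h: "n \<le> 2 * h" "2 * h \<le> n + 1" unfolding h_def by linarith+
    show False
    proof (cases "h + \<alpha> < n")
      case True
      have "\<exists>y\<in>{P, Q, R}. n \<le> 2 * offset n (h + \<alpha>) (?r y)" using \<alpha> h True by (intro spread') auto
      then obtain y where y: "y \<in> {P, Q, R}" "n \<le> 2 * offset n (h + \<alpha>) (?r y)" by blast
      have "?r y = 0 \<or> h + \<alpha> \<le> ?r y" using cases[OF y(1)] 2 \<alpha> h by auto
      then show False using y(2) \<alpha> h r[OF y(1)] True by (auto simp: offset_def split: if_splits)
    next
      case False
      have "?r y = 0" if "y \<in> {P, Q, R}" for y
        using cases[OF that] r[OF that] 2 \<alpha> h False by auto
      then have "?r P = ?r Q" by simp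
      then show False using offset_inj[of P n Q b] range dist by auto
    qed
  next
    case 3
    have "2 * ?r y = \<alpha> - k \<or> 2 * ?r y = n + \<alpha> + k" if "y \<in> {P, Q, R}" for y
      using cases[OF that] 3 by auto
    from this[of P] this[of Q] this[of R]
    have "?r P = ?r Q \<or> ?r P = ?r R \<or> ?r Q = ?r R" by auto
    then show False
      using offset_inj[of P n Q b] offset_inj[of P n R b] offset_inj[of Q n R b] range dist by auto
  qed
qed

text \<open>Going round from \<open>c\<close>, the landmark met last is the one that starts the gap
  containing \<open>c\<close>, so its offset is at least \<open>n\<close> minus the length of that
  gap.\<close>

lemma spread_gaps:
  assumes "0 \<le> P" "P < Q" "Q < R" "R < n"
      "2 * (Q - P) \<le> n" "2 * (R - Q) \<le> n" "2 * (n - R + P) \<le> n"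
  shows "spread n {P, Q, R}"
  unfolding spread_def
proof (intro allI impI)
  fix c assume c: "0 \<le> c \<and> c < n"
  consider "c \<le> P" | "P < c" "c \<le> Q" | "Q < c" "c \<le> R" | "R < c" by linarith
  then show "\<exists>y\<in>{P, Q, R}. n \<le> 2 * offset n c y"
    by cases (use assms c in \<open>auto simp: offset_def\<close>)
qed

text \<open>The larger of the two gaps between \<open>P\<close> and \<open>Q\<close> is cut after
  \<open>n div 2\<close> steps; it has at most n - 1 edges, so both pieces have at most n/2. If the
  gaps are equal, any third point will do. In the last case the new point wraps past position
  0.\<close>

lemma spread_third_point:
  fixes n P Q :: int
  assumes "3 \<le> n" "0 \<le> P" "P < Q" "Q < n"
  shows "\<exists>t. 0 \<le> t \<and> t < n \<and> t \<noteq> P \<and> t \<noteq> Q \<and> spread n {P, Q, t}"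
proof -
  define h where "h = n div 2"
  have h: "2 * h \<le> n" "n \<le> 2 * h + 1" "1 \<le> h"
    using assms(1) unfolding h_def by linarith+
  consider "2 * (Q - P) = n" | "2 * (Q - P) > n" | "2 * (Q - P) < n" "Q + h < n"
    | "2 * (Q - P) < n" "Q + h \<ge> n" by linarith
  then show ?thesis
  proof cases
    case 1
    then have "spread n {P, P + 1, Q}" using assms by (intro spread_gaps) auto
    then show ?thesis using 1 assms by (intro exI[of _ "P + 1"]) (auto simp: insert_commute)
  next
    case 2
    then have "spread n {P, P + h, Q}" using assms h by (intro spread_gaps) auto
    then show ?thesis using 2 assms h by (intro exI[of _ "P + h"]) (auto simp: insert_commute)
  next
    case 3
    then have "spread n {P, Q, Q + h}" using assms h by (intro spread_gaps) auto
    then show ?thesis using 3 assms h by (intro exI[of _ "Q + h"]) auto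
  next
    case 4
    then have "spread n {Q + h - n, P, Q}" using assms h by (intro spread_gaps) auto
    then show ?thesis using 4 assms h by (intro exI[of _ "Q + h - n"]) (auto simp: insert_commute)
  qed
qed

lemma cyclic_dist_doubly_resolving_third:
  fixes n P Q :: int
  assumes "3 \<le> n" "0 \<le> P" "P < n" "0 \<le> Q" "Q < n" "P \<noteq> Q"
  obtains t where "0 \<le> t" "t < n"
    "\<And>a b k. \<lbrakk>0 \<le> a; a < n; 0 \<le> b; b < n;
       \<And>y. y \<in> {P, Q, t} \<Longrightarrow> cyclic_dist n y a - cyclic_dist n y b = k\<rbrakk> \<Longrightarrow> a = b"
proof -
  have "\<exists>t. 0 \<le> t \<and> t < n \<and> t \<noteq> P \<and> t \<noteq> Q \<and> spread n {P, Q, t}"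
    using spread_third_point[of n P Q] spread_third_point[of n Q P] assms
    by (cases "P < Q") (auto simp: insert_commute)
  then obtain t where t: "0 \<le> t" "t < n" "t \<noteq> P" "t \<noteq> Q" "spread n {P, Q, t}" by blast
  have "a = b" if ab: "0 \<le> a" "a < n" "0 \<le> b" "b < n"
    and eq: "\<And>y. y \<in> {P, Q, t} \<Longrightarrow> cyclic_dist n y a - cyclic_dist n y b = k" for a b k
  proof (rule ccontr)
    assume "a \<noteq> b"
    \<comment> \<open>One of the two arcs between \<open>a\<close> and \<open>b\<close> has at most
      n/2 edges, and exchanging \<open>a\<close> and \<open>b\<close> only changes the sign of
      \<open>k\<close>.\<close>
    then have "2 * offset n b a \<le> n \<or> 2 * offset n a b \<le> n"
      by (auto simp: offset_def)
    then consider "2 * offset n b a \<le> n" | "2 * offset n a b \<le> n" by blast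
    then show False
    proof cases
      case 1
      show False
        by (rule cyclic_dist_doubly_resolving[of P Q t n a b k]) (use 1 t ab eq assms \<open>a \<noteq> b\<close> in auto)
    next
      case 2
      have "cyclic_dist n y b - cyclic_dist n y a = - k" if "y \<in> {P, Q, t}" for y
        using eq[OF that] by simp
      then show False
        using cyclic_dist_doubly_resolving[of P Q t n b a "- k"] 2 t ab assms \<open>a \<noteq> b\<close> by auto
    qed
  qed
  then show ?thesis using t that by blast
qed

lemma cyclic_dist_Suc_mod:
  assumes "i < n" "j < n"
  shows "cyclic_dist (int n) (int i) (int j) \<le> cyclic_dist (int n) (int (Suc i mod n)) (int j) + 1"
      (is ?thesis1)
    and "cyclic_dist (int n) (int (Suc i mod n)) (int j) \<le> cyclic_dist (int n) (int i) (int j) + 1"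
      (is ?thesis2)
proof -
  have step: "min x (m - x) \<le> min y (m - y) + 1" if "x \<le> y + 1" "y \<le> x + 1" for x y m :: int
    using that by auto
  have "?thesis1 \<and> ?thesis2"
  proof (cases "Suc i = n")
    case True
    then have "\<bar>int i - int j\<bar> = int n - 1 - int j" "Suc i mod n = 0" using assms by auto
    then show ?thesis by (auto simp: cyclic_dist_def)
  next
    case False
    then have "Suc i mod n = Suc i" using assms by simp
    then show ?thesis unfolding cyclic_dist_def by (auto intro!: step)
  qed
  then show ?thesis1 ?thesis2 by auto
qed


section \<open>Cycles given by vertex lists\<close>

text \<open>Splitting off the closing edge removes the modular index, so that the remaining edges
  match \<open>successively\<close>.\<close>

lemma cycle_edges_conv:
  assumes "p \<noteq> []"
  shows "cycle_edges p = insert {last p, hd p} {{p ! i, p ! Suc i} | i. Suc i < length p}"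
proof
  show "cycle_edges p \<subseteq> insert {last p, hd p} {{p ! i, p ! Suc i} | i. Suc i < length p}"
  proof
    fix e assume "e \<in> cycle_edges p"
    then obtain i where i: "i < length p" "e = {p ! i, p ! (Suc i mod length p)}"
      unfolding cycle_edges_def by blast
    show "e \<in> insert {last p, hd p} {{p ! i, p ! Suc i} | i. Suc i < length p}"
    proof (cases "Suc i = length p")
      case True
      then have "i = length p - 1" by simp
      with True i assms show ?thesis by (simp add: last_conv_nth hd_conv_nth)
    next
      case False
      with i have "Suc i < length p" by simp
      with i show ?thesis by auto
    qed
  qed
  have "{last p, hd p} = {p ! (length p - 1), p ! (Suc (length p - 1) mod length p)}"
    using assms by (simp add: last_conv_nth hd_conv_nth)
  moreover have "length p - 1 < length p" using assms by simp
  ultimately have "{last p, hd p} \<in> cycle_edges p" unfolding cycle_edges_def by blast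
  moreover have "{p ! i, p ! Suc i} \<in> cycle_edges p" if "Suc i < length p" for i
  proof -
    have "{p ! i, p ! Suc i} = {p ! i, p ! (Suc i mod length p)}" using that by simp
    then show ?thesis using that unfolding cycle_edges_def by (blast dest: Suc_lessD)
  qed
  ultimately show "insert {last p, hd p} {{p ! i, p ! Suc i} | i. Suc i < length p} \<subseteq> cycle_edges p"
    by blast
qed

lemma cactus_cycle_edges_eq:
  assumes "cactus V E" "is_cycle V E p" "is_cycle V E q" "e \<in> cycle_edges p" "e \<in> cycle_edges q"
  shows "cycle_edges p = cycle_edges q"
proof -
  have "e \<in> E" using assms by (auto simp: is_cycle_def)
  with assms show ?thesis unfolding cactus_def by blast
qed

lemma cycle_edges_subsetI:
  assumes "p \<noteq> []" "successively (\<lambda>x y. {x, y} \<in> F) p" "{last p, hd p} \<in> F"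
  shows "cycle_edges p \<subseteq> F"
  using assms by (auto simp: cycle_edges_conv successively_conv_nth)

text \<open>The vertices of a cycle are thus determined by its edge set, the form in which cycles
  are counted.\<close>

lemma Union_cycle_edges: "\<Union> (cycle_edges p) = set p"
proof
  show "\<Union> (cycle_edges p) \<subseteq> set p"
  proof
    fix x assume "x \<in> \<Union> (cycle_edges p)"
    then obtain i where i: "i < length p" "x \<in> {p ! i, p ! (Suc i mod length p)}"
      by (auto simp: cycle_edges_def)
    have "Suc i mod length p < length p" using i by (intro mod_less_divisor) auto
    with i show "x \<in> set p" by auto
  qed
  show "set p \<subseteq> \<Union> (cycle_edges p)"
  proof
    fix x assume "x \<in> set p"
    then obtain i where i: "i < length p" "x = p ! i" by (metis in_set_conv_nth)
    then have "{x, p ! (Suc i mod length p)} \<in> cycle_edges p" unfolding cycle_edges_def by blast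
    then show "x \<in> \<Union> (cycle_edges p)" by blast
  qed
qed


section \<open>Distances in connected graphs\<close>

lemma successively_imp_relpowp:
  "successively R (x # xs) \<Longrightarrow> (R ^^ length xs) x (last (x # xs))"
proof (induction xs arbitrary: x)
  case (Cons y ys)
  then show ?case
    by (auto simp del: relpowp.simps intro: relpowp_Suc_I2)
qed simp

lemma rtranclp_sym:
  assumes "\<And>x y. R x y \<Longrightarrow> R y x" "R\<^sup>*\<^sup>* x y"
  shows "R\<^sup>*\<^sup>* y x"
  using assms by (metis sympI sympD symp_rtranclp)

text \<open>A walk is shortened to a path: if the new endpoint already occurs, the list is cut off
  there.\<close>

lemma rtranclp_imp_distinct_successively:
  assumes "R\<^sup>*\<^sup>* x y"
  shows "\<exists>xs. successively R xs \<and> distinct xs \<and> xs \<noteq> [] \<and> hd xs = x \<and> last xs = y"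
  using assms
proof (induction rule: rtranclp_induct)
  case base
  show ?case by (intro exI[of _ "[x]"]) simp
next
  case (step y z)
  then obtain xs where xs: "successively R xs" "distinct xs" "xs \<noteq> []" "hd xs = x" "last xs = y"
    by blast
  show ?case
  proof (cases "z \<in> set xs")
    case True
    then obtain us vs where us: "xs = us @ z # vs" by (meson split_list)
    have "successively R (us @ [z])" using xs(1) unfolding us
      by (auto simp: successively_append_iff successively_Cons)
    moreover have "hd (us @ [z]) = x" using xs(4) unfolding us by (cases us) auto
    ultimately show ?thesis using xs(2) unfolding us by (intro exI[of _ "us @ [z]"]) auto
  next
    case False
    with xs step(2) show ?thesis
      by (intro exI[of _ "xs @ [z]"]) (auto simp: successively_append_iff)
  qed
qed

locale connected_simple_graph =
  fixes V :: "'a set" and E :: "'a set set"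
  assumes graph: "finite_simple_graph V E" and conn: "connected_graph V E"
begin

abbreviation d :: "'a \<Rightarrow> 'a \<Rightarrow> nat" where "d \<equiv> graph_dist V E"

definition adj :: "'a \<Rightarrow> 'a \<Rightarrow> bool" where "adj x y \<longleftrightarrow> {x, y} \<in> E"

lemma finite_V: "finite V"
  using graph by (simp add: finite_simple_graph_def)

lemma finite_E: "finite E"
proof (rule finite_subset)
  show "E \<subseteq> Pow V" using graph by (auto simp: finite_simple_graph_def)
qed (simp add: finite_V)

lemma adj_sym: "adj x y \<Longrightarrow> adj y x"
  by (simp add: adj_def insert_commute)

lemma adjD:
  assumes "adj x y"
  shows "x \<in> V" "y \<in> V" "x \<noteq> y"
  using assms graph by (auto simp: adj_def finite_simple_graph_def)

text \<open>Walks, unlike the paths in \<open>graph_dist\<close>, can be concatenated freely, which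
  yields the triangle inequality. On \<open>V\<close> both notions agree by
  \<open>dist_eq_hops\<close>.\<close>

definition hops :: "'a \<Rightarrow> 'a \<Rightarrow> nat" where
  "hops u v = (LEAST n. (adj ^^ n) u v)"

lemma path_relpowp:
  assumes "is_path V E u p v"
  shows "(adj ^^ (length p - 1)) u v"
proof -
  obtain x xs where p: "p = x # xs" using assms by (cases p) (auto simp: is_path_def)
  show ?thesis using assms successively_imp_relpowp[of adj x xs]
    by (auto simp: is_path_def p adj_def)
qed

lemma relpowp_hops:
  assumes "u \<in> V" "v \<in> V"
  shows "(adj ^^ hops u v) u v"
proof -
  obtain p where "is_path V E u p v" using conn assms by (auto simp: connected_graph_def)
  then show ?thesis unfolding hops_def using path_relpowp LeastI by metis
qed

lemma hops_le: "(adj ^^ n) u v \<Longrightarrow> hops u v \<le> n"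
  unfolding hops_def by (rule Least_le)

text \<open>The bound along the list is what keeps it distinct: the vertex prepended next has a
  larger value of \<open>hops\<close>, so it has not occurred before.\<close>

lemma hops_path:
  assumes "u \<in> V" "v \<in> V"
  shows "\<exists>p. is_path V E u p v \<and> length p = Suc (hops u v) \<and> (\<forall>w\<in>set p. hops w v \<le> hops u v)"
  using assms(1)
proof (induction "hops u v" arbitrary: u)
  case 0
  then have "u = v" using relpowp_hops[of u v] assms(2) by simp
  with 0 show ?case by (intro exI[of _ "[u]"]) (auto simp: is_path_def)
next
  case (Suc n)
  have "(adj ^^ Suc n) u v" using relpowp_hops[of u v] Suc assms(2) by simp
  then obtain w where w: "adj u w" "(adj ^^ n) w v" by (rule relpowp_Suc_E2)
  have wV: "w \<in> V" using w adjD by blast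
  have "hops u v \<le> Suc (hops w v)"
    using hops_le relpowp_Suc_I2[OF w(1) relpowp_hops[OF wV assms(2)]] by blast
  then have n: "n = hops w v" using Suc(2) hops_le[OF w(2)] by simp
  from Suc(1)[OF n wV] obtain p where p: "is_path V E w p v" "length p = Suc n"
    "\<forall>x\<in>set p. hops x v \<le> n" using n by auto
  have "u \<notin> set p" using p(3) Suc(2) by force
  then have "is_path V E u (u # p) v"
    using p(1) w(1) Suc(3) by (cases p) (auto simp: is_path_def adj_def)
  then show ?case using p Suc(2)
    by (intro exI[of _ "u # p"]) force
qed

lemma dist_eq_hops:
  assumes "u \<in> V" "v \<in> V"
  shows "d u v = hops u v"
  unfolding graph_dist_def
proof (rule Least_equality)
  show "\<exists>p. is_path V E u p v \<and> hops u v = length p - 1"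
    using hops_path[OF assms] by auto
qed (auto dest!: path_relpowp hops_le)

lemma dist_le:
  assumes "(adj ^^ n) u v" "u \<in> V" "v \<in> V"
  shows "d u v \<le> n"
  using assms hops_le dist_eq_hops by simp

lemma dist_walk: "u \<in> V \<Longrightarrow> v \<in> V \<Longrightarrow> (adj ^^ d u v) u v"
  using relpowp_hops dist_eq_hops by simp

lemma dist_refl [simp]: "u \<in> V \<Longrightarrow> d u u = 0"
  using dist_le[of 0 u u] by simp

lemma dist_eq_0_iff: "u \<in> V \<Longrightarrow> v \<in> V \<Longrightarrow> d u v = 0 \<longleftrightarrow> u = v"
  using dist_walk[of u v] by fastforce

lemma dist_triangle:
  assumes "u \<in> V" "v \<in> V" "w \<in> V"
  shows "d u w \<le> d u v + d v w"
proof (rule dist_le)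
  show "(adj ^^ (d u v + d v w)) u w"
    unfolding relpowp_add using dist_walk assms by blast
qed (use assms in auto)

lemma dist_sym:
  assumes "u \<in> V" "v \<in> V"
  shows "d u v = d v u"
proof -
  have rev: "(adj ^^ n) y x" if "(adj ^^ n) x y" for n x y
    using that
  proof (induction n arbitrary: x)
    case (Suc n)
    then obtain z where "adj x z" "(adj ^^ n) z y" by (metis relpowp_Suc_D2)
    then show ?case using Suc.IH adj_sym relpowp_Suc_I by metis
  qed auto
  then show ?thesis
    using dist_le dist_walk assms by (meson antisym)
qed

lemma dist_adj: "adj u v \<Longrightarrow> d u v = 1"
  using dist_le[of 1 u v] adjD[of u v] dist_eq_0_iff[of u v] by fastforce

lemma dist_adj_le:
  assumes "adj u w" "v \<in> V"
  shows "d u v \<le> Suc (d w v)"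
  using dist_triangle[of u w v] dist_adj adjD assms by fastforce

lemma dist_step:
  assumes "u \<in> V" "v \<in> V" "u \<noteq> v"
  obtains w where "adj u w" "d u v = Suc (d w v)"
proof -
  obtain n where n: "d u v = Suc n" using dist_eq_0_iff[of u v] assms by (cases "d u v") auto
  then obtain w where w: "adj u w" "(adj ^^ n) w v"
    using dist_walk[OF assms(1,2)] by (metis relpowp_Suc_D2)
  have "w \<in> V" using w(1) adjD by blast
  with w assms(2) n dist_le[of n w v] dist_adj_le[of u w v] show ?thesis using that by fastforce
qed

end


section \<open>The retraction of a cactus onto one of its cycles\<close>

locale cactus_cycle = connected_simple_graph +
  fixes p :: "'a list"
  assumes cactus: "cactus V E" and cycle: "is_cycle V E p"
begin

lemma length_p: "3 \<le> length p" and distinct_p: "distinct p" and p_V: "set p \<subseteq> V"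
  and cycle_edges_E: "cycle_edges p \<subseteq> E" and p_not_Nil: "p \<noteq> []"
  using cycle by (auto simp: is_cycle_def)

lemma nth_p_V: "i < length p \<Longrightarrow> p ! i \<in> V"
  using p_V by auto

section \<open>Walks that avoid the edges of the cycle\<close>

definition off :: "'a \<Rightarrow> 'a \<Rightarrow> bool" where
  "off x y \<longleftrightarrow> {x, y} \<in> E - cycle_edges p"

lemma off_sym: "off x y \<Longrightarrow> off y x"
  by (simp add: off_def insert_commute)

lemma off_adj: "off x y \<Longrightarrow> adj x y"
  by (simp add: off_def adj_def)

text \<open>A detour off the cycle would close up, with an arc of the cycle, to a second cycle through
  the edges of that arc.\<close>

lemma no_off_detour:
  assumes ij: "i < j" "j < length p" and ys: "successively off (p ! j # ys @ [p ! i])"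
    "distinct ys" "set ys \<inter> set p = {}"
  shows False
proof -
  define seg where "seg = map ((!) p) [i..<Suc j]"
  have seg_nth: "seg ! k = p ! (i + k)" if "k < Suc j - i" for k
    using that unfolding seg_def by (simp del: upt_Suc)
  have len: "length seg = Suc j - i" by (simp add: seg_def del: upt_Suc)
  have ne: "seg \<noteq> []" using len ij by auto
  have hd: "hd seg = p ! i" using ne seg_nth[of 0] ij by (simp add: hd_conv_nth)
  have last: "last seg = p ! j"
    using ne seg_nth[of "j - i"] ij len by (simp add: last_conv_nth Suc_diff_le)
  have edge: "{p ! k, p ! Suc k} \<in> cycle_edges p" if "Suc k < length p" for k
    using that p_not_Nil by (auto simp: cycle_edges_conv)
  have set_seg: "set seg \<subseteq> set p" using ij by (auto simp: seg_def)
  have succ_seg: "successively (\<lambda>x y. {x, y} \<in> E) seg"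
    unfolding successively_conv_nth using len ij seg_nth edge cycle_edges_E by force
  have dist_seg: "distinct seg"
    using distinct_p ij unfolding seg_def by (auto simp: distinct_map inj_on_def nth_eq_iff_index_eq)
  have ysE: "successively (\<lambda>x y. {x, y} \<in> E) (p ! j # ys @ [p ! i])"
    using ys(1) by (rule successively_mono) (auto simp: off_def)
  have ysV: "set ys \<subseteq> V"
  proof -
    have "set zs \<subseteq> V" if "successively (\<lambda>x y. {x, y} \<in> E) (x # zs)" for x zs
      using that by (induction zs arbitrary: x) (auto intro: adjD(2) simp: adj_def)
    from this[OF ysE] show ?thesis by simp
  qed
  have closing: "off (last (seg @ ys)) (hd seg)"
    using ys(1) hd last ne
    by (cases ys rule: rev_cases) (auto simp: successively_append_iff successively_Cons)
  have "3 \<le> length (seg @ ys)"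
  proof (cases "ys = []")
    \<comment> \<open>The detour is a single edge off the cycle, so it does not join consecutive
      positions, and the arc alone has three vertices.\<close>
    case True
    then have "off (p ! j) (p ! i)" using ys(1) by simp
    then have "j \<noteq> Suc i" using edge[of i] ij by (auto simp: off_def insert_commute)
    then show ?thesis using len ij by simp
  next
    case False
    then have "1 \<le> length ys" by (cases ys) auto
    then show ?thesis using len ij by simp
  qed
  moreover have "distinct (seg @ ys)" using dist_seg ys set_seg by auto
  moreover have "set (seg @ ys) \<subseteq> V" using set_seg p_V ysV by auto
  moreover have "cycle_edges (seg @ ys) \<subseteq> E"
  proof (rule cycle_edges_subsetI)
    show "successively (\<lambda>x y. {x, y} \<in> E) (seg @ ys)"
      using succ_seg ysE last successively_append_iff[of _ "p ! j # ys" "[p ! i]"]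
      by (cases ys) (auto simp: successively_append_iff)
    show "{last (seg @ ys), hd (seg @ ys)} \<in> E" using closing ne by (simp add: off_def)
  qed (use ne in simp)
  ultimately have cyc: "is_cycle V E (seg @ ys)" by (simp add: is_cycle_def)
  have "{seg ! 0, seg ! Suc 0} \<in> cycle_edges (seg @ ys)"
  proof -
    have "Suc 0 < length seg" using len ij by simp
    then show ?thesis using ne
      by (auto simp: cycle_edges_conv nth_append intro!: exI[of _ 0])
  qed
  moreover have "{seg ! 0, seg ! Suc 0} = {p ! i, p ! Suc i}"
    using seg_nth[of 0] seg_nth[of "Suc 0"] ij by simp
  ultimately have "{p ! i, p ! Suc i} \<in> cycle_edges (seg @ ys)" by simp
  moreover have "{p ! i, p ! Suc i} \<in> cycle_edges p" using edge ij by simp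
  ultimately have "cycle_edges (seg @ ys) = cycle_edges p"
    by (rule cactus_cycle_edges_eq[OF cactus cyc cycle])
  \<comment> \<open>This edge belongs to the detour and not to \<open>p\<close>, so the two edge
    sets differ after all.\<close>
  moreover have "{last (seg @ ys), hd (seg @ ys)} \<in> cycle_edges (seg @ ys)"
    using ne by (simp add: cycle_edges_conv)
  ultimately show False using closing ne by (simp add: off_def)
qed

text \<open>Induction on the length. A repeated vertex, or an inner vertex on the cycle, leads to a
  shorter walk; otherwise the walk is a detour as in \<open>no_off_detour\<close>, possibly read
  backwards.\<close>

lemma successively_off_cycle_eq:
  assumes "successively off xs" "xs \<noteq> []" "hd xs \<in> set p" "last xs \<in> set p"
  shows "hd xs = last xs"
  using assms
proof (induction xs rule: length_induct)
  case (1 xs)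
  show ?case
  proof (rule ccontr)
    assume ne: "hd xs \<noteq> last xs"
    then obtain a ys b where xs: "xs = a # ys @ [b]"
      using 1(3) by (cases xs; cases "tl xs" rule: rev_cases) auto
    have ab: "a \<in> set p" "b \<in> set p" "a \<noteq> b" using 1 ne xs by auto
    have dist: "distinct xs"
    proof (rule ccontr)
      assume "\<not> distinct xs"
      then obtain us y vs ws where d: "xs = us @ [y] @ vs @ [y] @ ws"
        using not_distinct_decomp by blast
      let ?zs = "us @ [y] @ ws"
      have "successively off ?zs"
        using 1(2) unfolding d by (auto simp: successively_append_iff successively_Cons)
      moreover have "hd ?zs = hd xs" "last ?zs = last xs"
        unfolding d by (cases us; simp) (cases ws rule: rev_cases; simp)
      moreover have "length ?zs < length xs" unfolding d by simp
      ultimately show False using 1 ne by (metis Nil_is_append_conv not_Cons_self2)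
    qed
    have disj: "set ys \<inter> set p = {}"
    proof (rule ccontr)
      assume "set ys \<inter> set p \<noteq> {}"
      then obtain c where c: "c \<in> set ys" "c \<in> set p" by blast
      then obtain us vs where ys: "ys = us @ c # vs" by (meson split_list)
      have "successively off (a # us @ [c])"
        using 1(2) successively_append_iff[of off "a # us @ [c]" "vs @ [b]"] unfolding xs ys by simp
      moreover have "length (a # us @ [c]) < length xs" unfolding xs ys by simp
      ultimately have "hd (a # us @ [c]) = last (a # us @ [c])"
        using 1(1) ab c by (metis hd_Cons_tl last_ConsR last_snoc list.distinct(1) list.sel(1) snoc_eq_iff_butlast)
      then show False using dist c unfolding xs by auto
    qed
    obtain i j where i: "i < length p" "a = p ! i" and j: "j < length p" "b = p ! j"
      using ab by (metis in_set_conv_nth)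
    have "i \<noteq> j" using ab i j by auto
    then consider "j < i" | "i < j" by linarith
    then show False
    proof cases
      case 1
      show False
        by (rule no_off_detour[OF 1 i(1), of ys]) (use "1.prems" xs i j dist disj in auto)
    next
      case 2
      have "successively off (rev xs)"
        unfolding successively_rev using "1.prems"(1) by (rule successively_mono) (auto intro: off_sym)
      then show False
        by (intro no_off_detour[OF 2 j(1), of "rev ys"]) (use xs i j dist disj in auto)
    qed
  qed
qed

text \<open>A component of the graph without the cycle edges contains at most one vertex of the
  cycle, so the choice in \<open>gate\<close> is unique.\<close>

lemma off_rtranclp_cycle_eq:
  assumes "off\<^sup>*\<^sup>* x y" "x \<in> set p" "y \<in> set p"
  shows "x = y"
proof -
  obtain xs where "successively off xs" "xs \<noteq> []" "hd xs = x" "last xs = y"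
    using rtranclp_imp_distinct_successively[OF assms(1)] by blast
  then show ?thesis using successively_off_cycle_eq assms by blast
qed

text \<open>A geodesic towards a vertex of the cycle uses no cycle edge before it first meets the
  cycle, since cycle edges have both ends there.\<close>

lemma off_reaches_cycle:
  assumes "z \<in> V"
  shows "\<exists>g\<in>set p. off\<^sup>*\<^sup>* z g"
proof -
  obtain c where c: "c \<in> set p" "c \<in> V" using p_not_Nil p_V by (cases p) auto
  show ?thesis using assms
  proof (induction "d z c" arbitrary: z)
    case 0
    then show ?case using dist_eq_0_iff c by auto
  next
    case (Suc k)
    show ?case
    proof (cases "z \<in> set p")
      case False
      have "z \<noteq> c" using c False by auto
      then obtain w where w: "adj z w" "d z c = Suc (d w c)" using dist_step Suc.prems c by blast
      have "{z, w} \<notin> cycle_edges p" using False Union_cycle_edges[of p] by blast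
      then have "off z w" using w by (simp add: off_def adj_def)
      moreover have "\<exists>g\<in>set p. off\<^sup>*\<^sup>* w g" using Suc w adjD by auto
      ultimately show ?thesis by (meson converse_rtranclp_into_rtranclp)
    qed blast
  qed
qed

section \<open>Gates and distances through them\<close>

definition gate :: "'a \<Rightarrow> 'a" where
  "gate z = (SOME g. g \<in> set p \<and> off\<^sup>*\<^sup>* z g)"

lemma gate:
  assumes "z \<in> V"
  shows "gate z \<in> set p" "off\<^sup>*\<^sup>* z (gate z)"
proof -
  have "\<exists>g. g \<in> set p \<and> off\<^sup>*\<^sup>* z g" using off_reaches_cycle[OF assms] by blast
  then have "gate z \<in> set p \<and> off\<^sup>*\<^sup>* z (gate z)" unfolding gate_def by (rule someI_ex)
  then show "gate z \<in> set p" "off\<^sup>*\<^sup>* z (gate z)" by auto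
qed

lemma gate_off:
  assumes "off x y"
  shows "gate x = gate y"
proof -
  have V: "x \<in> V" "y \<in> V" using assms off_adj adjD by blast+
  have "off\<^sup>*\<^sup>* (gate x) (gate y)"
    using gate[OF V(1)] gate[OF V(2)] assms rtranclp_sym[of off] off_sym
    by (meson converse_rtranclp_into_rtranclp rtranclp_trans)
  then show ?thesis using off_rtranclp_cycle_eq gate V by blast
qed

lemma gate_id: "x \<in> set p \<Longrightarrow> gate x = x"
  using off_rtranclp_cycle_eq gate p_V by (metis subsetD)

lemma gate_V: "z \<in> V \<Longrightarrow> gate z \<in> V"
  using gate p_V by blast

lemma adj_cases:
  assumes "adj x y"
  obtains "gate x = gate y" | "{x, y} \<in> cycle_edges p" "x \<in> set p" "y \<in> set p" "gate x = x" "gate y = y"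
proof (cases "{x, y} \<in> cycle_edges p")
  case True
  then have "x \<in> set p" "y \<in> set p" using Union_cycle_edges[of p] by blast+
  then show ?thesis using that True gate_id by blast
next
  case False
  then show ?thesis using assms gate_off that unfolding off_def adj_def by blast
qed

text \<open>A geodesic to a vertex with another gate has to leave the component of \<open>x\<close>
  by a cycle edge, hence at \<open>gate x\<close>. In the induction, a step from a vertex off the
  cycle keeps the gate.\<close>

lemma dist_through_gate:
  assumes "x \<in> V" "y \<in> V" "gate x \<noteq> gate y"
  shows "d x y = d x (gate x) + d (gate x) y"
proof (rule antisym)
  show "d x y \<le> d x (gate x) + d (gate x) y"
    using dist_triangle gate_V assms by blast
  show "d x (gate x) + d (gate x) y \<le> d x y"
    using assms(1,3)
  proof (induction "d x y" arbitrary: x)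
    case 0
    then show ?case using dist_eq_0_iff assms(2) by auto
  next
    case (Suc k)
    show ?case
    proof (cases "x \<in> set p")
      case True
      then show ?thesis using gate_id Suc.prems by simp
    next
      case False
      have "x \<noteq> y" using Suc.prems by auto
      then obtain w where w: "adj x w" "d x y = Suc (d w y)" using dist_step Suc.prems assms(2) by blast
      have g: "gate w = gate x" using w(1) False by (cases rule: adj_cases) auto
      have "d w (gate w) + d (gate w) y \<le> d w y"
        using Suc.hyps(1)[of w] Suc.hyps(2) Suc.prems w g adjD(2)[OF w(1)] by simp
      moreover have "d x (gate x) \<le> Suc (d w (gate x))" using dist_adj_le w gate_V Suc.prems by blast
      ultimately show ?thesis using w g by simp
    qed
  qed
qed

lemma dist_through_gates:
  assumes "x \<in> V" "y \<in> V" "gate x \<noteq> gate y"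
  shows "d x y = d x (gate x) + d (gate x) (gate y) + d (gate y) y"
proof -
  have "d y (gate x) = d y (gate y) + d (gate y) (gate x)"
    using assms gate_V gate_id gate by (intro dist_through_gate) auto
  then show ?thesis
    using dist_through_gate[OF assms] dist_sym assms gate_V by simp
qed

lemma dist_from_cycle:
  assumes "c \<in> set p" "x \<in> V"
  shows "d c x = d c (gate x) + d (gate x) x"
proof (cases "c = gate x")
  case True
  then show ?thesis using assms gate_V by simp
next
  case False
  then show ?thesis using dist_through_gates[of c x] assms gate_id p_V by auto
qed

section \<open>Distances between vertices of the cycle\<close>

lemma consecutive_on_cycle:
  assumes "{p ! i, p ! j} \<in> cycle_edges p" "i < length p" "j < length p"
  shows "j = Suc i mod length p \<or> i = Suc j mod length p"
proof -
  obtain k where k: "k < length p" "{p ! i, p ! j} = {p ! k, p ! (Suc k mod length p)}"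
    using assms(1) by (auto simp: cycle_edges_def)
  have "Suc k mod length p < length p" using k by (intro mod_less_divisor) auto
  then show ?thesis using k assms distinct_p by (auto simp: doubleton_eq_iff nth_eq_iff_index_eq)
qed

abbreviation cd :: "nat \<Rightarrow> nat \<Rightarrow> int" where
  "cd i j \<equiv> cyclic_dist (int (length p)) (int i) (int j)"

text \<open>The retraction does not increase distances: along each edge of a geodesic the gate moves
  by at most one position.\<close>

lemma cyclic_dist_le_dist:
  assumes "j < length p" "z \<in> V" "i < length p" "gate z = p ! i"
  shows "cd i j \<le> int (d z (p ! j))"
  using assms(2-4)
proof (induction "d z (p ! j)" arbitrary: z i)
  case 0
  then have "z = p ! j" using dist_eq_0_iff nth_p_V assms(1) by auto
  then have "i = j" using 0 gate_id assms(1) distinct_p by (auto simp: nth_eq_iff_index_eq)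
  then show ?case by (simp add: cyclic_dist_def)
next
  case (Suc k)
  have "z \<noteq> p ! j" using Suc dist_refl nth_p_V assms(1) by force
  then obtain w where w: "adj z w" "d z (p ! j) = Suc (d w (p ! j))"
    using dist_step Suc.prems nth_p_V assms(1) by blast
  have IH: "cd m j \<le> int k" if "m < length p" "gate w = p ! m" for m
    using Suc.hyps(1)[of w m] Suc.hyps(2) w adjD(2)[OF w(1)] that by simp
  from w(1) show ?case
  proof (cases rule: adj_cases)
    case 1
    then show ?thesis using IH[of i] Suc by simp
  next
    case 2
    then obtain m where m: "m < length p" "w = p ! m" by (metis in_set_conv_nth)
    have "z = p ! i" using 2 Suc.prems by simp
    then have "m = Suc i mod length p \<or> i = Suc m mod length p"
      using consecutive_on_cycle[of i m] 2 m Suc.prems by simp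
    then have "cd i j \<le> cd m j + 1"
      using cyclic_dist_Suc_mod m(1) Suc.prems(2) assms(1) by metis
    then show ?thesis using IH[of m] 2 m Suc.hyps(2) by simp
  qed
qed

lemma dist_arc_le: "i \<le> j \<Longrightarrow> j < length p \<Longrightarrow> d (p ! i) (p ! j) \<le> j - i"
proof (induction j)
  case (Suc j)
  show ?case
  proof (cases "i = Suc j")
    case True
    then show ?thesis using nth_p_V Suc by simp
  next
    case False
    have "{p ! j, p ! Suc j} \<in> E"
      using Suc.prems cycle_edges_E p_not_Nil by (auto simp: cycle_edges_conv)
    then have "d (p ! j) (p ! Suc j) = 1" using dist_adj by (simp add: adj_def)
    then show ?thesis
      using dist_triangle[of "p ! i" "p ! j" "p ! Suc j"] nth_p_V Suc False by auto
  qed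
qed (use nth_p_V in simp)

lemma dist_le_cyclic_dist:
  assumes "i \<le> j" "j < length p"
  shows "int (d (p ! i) (p ! j)) \<le> cd i j"
proof -
  \<comment> \<open>The arc through the closing edge leads from \<open>p ! i\<close> down to
    \<open>p ! 0\<close>, over to the last vertex and down to \<open>p ! j\<close>.\<close>
  have "{last p, hd p} \<in> E" using cycle_edges_E p_not_Nil by (simp add: cycle_edges_conv)
  then have "adj (p ! 0) (p ! (length p - 1))"
    using p_not_Nil by (simp add: last_conv_nth hd_conv_nth adj_def insert_commute)
  then have "d (p ! 0) (p ! (length p - 1)) = 1" by (rule dist_adj)
  moreover have "d (p ! i) (p ! 0) \<le> i"
    using dist_arc_le[of 0 i] dist_sym[of "p ! i" "p ! 0"] nth_p_V[of i] nth_p_V[of 0] p_not_Nil assms by simp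
  moreover have "d (p ! (length p - 1)) (p ! j) \<le> length p - 1 - j"
    using dist_arc_le[of j "length p - 1"] dist_sym[of "p ! j" "p ! (length p - 1)"]
      nth_p_V[of j] nth_p_V[of "length p - 1"] p_not_Nil assms by simp
  moreover have "d (p ! i) (p ! j) \<le> d (p ! i) (p ! 0) + d (p ! 0) (p ! j)"
    "d (p ! 0) (p ! j) \<le> d (p ! 0) (p ! (length p - 1)) + d (p ! (length p - 1)) (p ! j)"
    using dist_triangle[of "p ! i" "p ! 0" "p ! j"]
      dist_triangle[of "p ! 0" "p ! (length p - 1)" "p ! j"]
      nth_p_V[of i] nth_p_V[of j] nth_p_V[of 0] nth_p_V[of "length p - 1"] p_not_Nil assms by auto
  ultimately have "d (p ! i) (p ! j) \<le> i + (1 + (length p - 1 - j))" by linarith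
  then show ?thesis using dist_arc_le[OF assms] assms by (auto simp: cyclic_dist_def)
qed

lemma dist_on_cycle:
  assumes "i < length p" "j < length p"
  shows "int (d (p ! i) (p ! j)) = cd i j"
proof (rule antisym)
  show "int (d (p ! i) (p ! j)) \<le> cd i j"
  proof (cases "i \<le> j")
    case False
    have "d (p ! i) (p ! j) = d (p ! j) (p ! i)" using dist_sym nth_p_V assms by blast
    moreover have "cd i j = cd j i" by (simp add: cyclic_dist_def abs_minus_commute)
    ultimately show ?thesis using dist_le_cyclic_dist[of j i] False assms by simp
  qed (use dist_le_cyclic_dist assms in blast)
  show "cd i j \<le> int (d (p ! i) (p ! j))"
    using cyclic_dist_le_dist nth_p_V gate_id assms by simp
qed

section \<open>Landmarks that determine the gate of a vertex\<close>

lemma third_doubly_resolving_vertex: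
  assumes "x \<in> set p" "y \<in> set p" "x \<noteq> y"
  obtains t where "t \<in> set p"
    "\<And>a b k. \<lbrakk>a \<in> set p; b \<in> set p; \<And>z. z \<in> {x, y, t} \<Longrightarrow> int (d z a) - int (d z b) = k\<rbrakk> \<Longrightarrow> a = b"
proof -
  obtain i j where i: "i < length p" "x = p ! i" and j: "j < length p" "y = p ! j"
    using assms by (metis in_set_conv_nth)
  have "i \<noteq> j" using i j assms by auto
  let ?n = "int (length p)"
  obtain s where s: "0 \<le> s" "s < ?n"
    and res: "\<And>a b k. \<lbrakk>0 \<le> a; a < ?n; 0 \<le> b; b < ?n;
       \<And>y. y \<in> {int i, int j, s} \<Longrightarrow> cyclic_dist ?n y a - cyclic_dist ?n y b = k\<rbrakk> \<Longrightarrow> a = b"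
    using cyclic_dist_doubly_resolving_third[of "int (length p)" "int i" "int j"] length_p i j \<open>i \<noteq> j\<close>
    by auto
  define m where "m = nat s"
  have m: "m < length p" "s = int m" using s by (auto simp: m_def)
  show ?thesis
  proof
    show "p ! m \<in> set p" using m by simp
    fix a b k assume ab: "a \<in> set p" "b \<in> set p"
      and eq: "\<And>z. z \<in> {x, y, p ! m} \<Longrightarrow> int (d z a) - int (d z b) = k"
    obtain a' b' where a': "a' < length p" "a = p ! a'" and b': "b' < length p" "b = p ! b'"
      using ab by (metis in_set_conv_nth)
    have "cd l a' - cd l b' = k" if "l \<in> {i, j, m}" for l
      using that eq[of "p ! l"] i j m a' b' dist_on_cycle by auto
    then have "int a' = int b'"
      using a' b' m by (intro res[of "int a'" "int b'" k]) auto
    then show "a = b" using a' b' by simp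
  qed
qed

text \<open>If the gate \<open>z\<close> of \<open>s\<close> differs from \<open>gate u\<close> and
  \<open>gate v\<close>, both distances from \<open>s\<close> pass through \<open>z\<close> and the
  part up to \<open>z\<close> cancels; so d(z, gate u) - d(z, gate v) does not depend on
  \<open>z\<close>. If \<open>z\<close> is one of these two gates, only one inequality follows
  directly, and a second point of \<open>X\<close> supplies the other. Then \<open>dres\<close>
  applies.\<close>

lemma unresolved_same_gate:
  assumes uv: "u \<in> V" "v \<in> V" and SV: "S \<subseteq> V"
    and unres: "\<And>s. s \<in> S \<Longrightarrow> d s u = d s v"
    and hit: "X \<subseteq> gate ` S" "x \<in> X" "y \<in> X" "x \<noteq> y"
    and dres: "\<And>a b k. \<lbrakk>a \<in> set p; b \<in> set p; \<And>z. z \<in> X \<Longrightarrow> int (d z a) - int (d z b) = k\<rbrakk> \<Longrightarrow> a = b"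
  shows "gate u = gate v"
proof (rule ccontr)
  let ?a = "gate u" and ?b = "gate v"
  assume ne: "?a \<noteq> ?b"
  have abV: "?a \<in> V" "?b \<in> V" using uv gate_V by auto
  have pos: "0 < d ?a ?b" using ne abV dist_eq_0_iff by (metis neq0_conv)
  have sym: "d ?a ?b = d ?b ?a" using abV dist_sym by blast
  have gen: "d z ?a + d ?a u = d z ?b + d ?b v" if z: "z \<in> X" "z \<noteq> ?a" "z \<noteq> ?b" for z
  proof -
    obtain s where s: "s \<in> S" "z = gate s" using hit z by blast
    then show ?thesis
      using unres[OF s(1)] dist_through_gates[of s u] dist_through_gates[of s v] z uv SV by auto
  qed
  have at_a: "d ?a ?b + d ?b v \<le> d ?a u" if z: "?a \<in> X"
  proof -
    obtain s where s: "s \<in> S" "?a = gate s" using hit z by blast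
    have "s \<in> V" using s SV by blast
    then show ?thesis
      using unres[OF s(1)] dist_triangle[of s ?a u] dist_through_gates[of s v] s uv abV ne by simp
  qed
  have at_b: "d ?a ?b + d ?a u \<le> d ?b v" if z: "?b \<in> X"
  proof -
    obtain s where s: "s \<in> S" "?b = gate s" using hit z by blast
    have "s \<in> V" using s SV by blast
    then show ?thesis
      using unres[OF s(1)] dist_triangle[of s ?b v] dist_through_gates[of s u] s uv abV ne sym by simp
  qed
  \<comment> \<open>Adding the two inequalities would give \<open>d ?a ?b = 0\<close>.\<close>
  have not_both: "\<not> (?a \<in> X \<and> ?b \<in> X)" using at_a at_b pos by fastforce
  have XV: "X \<subseteq> V" using hit(1) SV gate_V by blast
  have eq: "d z ?a + d ?a u = d z ?b + d ?b v" if z: "z \<in> X" for z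
  proof -
    consider "z \<noteq> ?a" "z \<noteq> ?b" | "z = ?a" | "z = ?b" by blast
    then show ?thesis
    proof cases
      case 1
      then show ?thesis using gen z by blast
    next
      case 2
      \<comment> \<open>The exact equation at \<open>w\<close> and the triangle inequality give the
        converse of \<open>at_a\<close>.\<close>
      obtain w where w: "w \<in> X" "w \<noteq> ?a" using hit by metis
      then have "w \<noteq> ?b" using not_both 2 z by blast
      then have "d w ?a + d ?a u = d w ?b + d ?b v" using gen w by blast
      moreover have "d w ?b \<le> d w ?a + d ?a ?b" using dist_triangle w XV abV by blast
      ultimately show ?thesis using at_a 2 z abV by simp
    next
      case 3
      obtain w where w: "w \<in> X" "w \<noteq> ?b" using hit by metis
      then have "w \<noteq> ?a" using not_both 3 z by blast
      then have "d w ?a + d ?a u = d w ?b + d ?b v" using gen w by blast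
      moreover have "d w ?a \<le> d w ?b + d ?b ?a" using dist_triangle w XV abV by blast
      ultimately show ?thesis using at_b 3 z abV sym by simp
    qed
  qed
  have "?a = ?b"
  proof (rule dres)
    show "int (d z ?a) - int (d z ?b) = int (d ?b v) - int (d ?a u)" if "z \<in> X" for z
      using eq[OF that] by linarith
  qed (use gate uv in auto)
  with ne show False ..
qed

end

section \<open>Zero forcing sets\<close>

text \<open>This says that a zero forcing set meets every fort. Consider the first force into
  \<open>F\<close>: the forcing vertex is black, hence outside \<open>F\<close>, while all of
  \<open>F\<close> is still white, so it has just one neighbour there.\<close>

lemma zero_forcing_fort:
  assumes "zero_forcing_set V E S" "F \<subseteq> V" "F \<noteq> {}" "S \<inter> F = {}"
  shows "\<exists>x w. x \<notin> F \<and> w \<in> F \<and> {x, w} \<in> E \<and> (\<forall>y\<in>F. {x, y} \<in> E \<longrightarrow> y = w)" (is ?P)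
proof -
  have "(force_step V E)\<^sup>*\<^sup>* S V" using assms(1) by (simp add: zero_forcing_set_def)
  then have "V \<inter> F = {} \<or> ?P"
  proof (induction rule: rtranclp_induct)
    case base
    then show ?case using assms(4) by simp
  next
    case (step B B')
    from step.hyps(2) obtain u v where u: "u \<in> B" and v: "{w \<in> V. {u, w} \<in> E \<and> w \<notin> B} = {v}"
      and B': "B' = insert v B" unfolding force_step_def by blast
    show ?case
    proof (cases "B \<inter> F = {} \<and> v \<in> F")
      case True
      have "{u, v} \<in> E" using v by blast
      moreover have "y = v" if "y \<in> F" "{u, y} \<in> E" for y using v that assms(2) True by blast
      ultimately show ?thesis using u True by blast
    next
      case False
      then show ?thesis using step.IH B' by blast
    qed
  qed
  then show ?thesis using assms(2,3) by blast
qed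

section \<open>Zero forcing sets seen from a cycle\<close>

context cactus_cycle
begin

text \<open>If \<open>g\<close> were the only gate, the first force to a vertex with another gate
  would use a cycle edge and so start at \<open>g\<close>; but both cycle neighbours of
  \<open>g\<close> are such vertices. For empty \<open>S\<close> any cycle vertex serves as
  \<open>g\<close>.\<close>

lemma zero_forcing_set_gates:
  assumes S: "zero_forcing_set V E S"
  shows "\<exists>s\<in>S. \<exists>s'\<in>S. gate s \<noteq> gate s'"
proof (rule ccontr)
  assume neg: "\<not> ?thesis"
  have SV: "S \<subseteq> V" using S by (simp add: zero_forcing_set_def)
  obtain g where g: "g \<in> set p" "\<forall>s\<in>S. gate s = g"
  proof (cases "S = {}")
    case True
    then show ?thesis using that[of "hd p"] p_not_Nil by simp
  next
    case False
    then obtain s where "s \<in> S" by blast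
    then show ?thesis using that[of "gate s"] neg gate SV by blast
  qed
  define F where "F = {x \<in> V. gate x \<noteq> g}"
  have F_cycle: "p ! k \<in> F" if "k < length p" "p ! k \<noteq> g" for k
    using that gate_id nth_p_V by (simp add: F_def)
  have "p ! 0 \<noteq> p ! 1" using nth_eq_iff_index_eq[OF distinct_p, of 0 1] length_p by force
  then have "p ! 0 \<noteq> g \<or> p ! 1 \<noteq> g" by metis
  then have "p ! 0 \<in> F \<or> p ! 1 \<in> F" using F_cycle[of 0] F_cycle[of 1] length_p by fastforce
  then have F: "F \<subseteq> V" "F \<noteq> {}" "S \<inter> F = {}" using g by (auto simp: F_def)
  obtain x w where xw: "x \<notin> F" "w \<in> F" "{x, w} \<in> E"
    "\<forall>y\<in>F. {x, y} \<in> E \<longrightarrow> y = w"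
    using zero_forcing_fort[OF S F] by blast
  have adj: "adj x w" using xw(3) by (simp add: adj_def)
  have gates: "gate x = g" "gate w \<noteq> g" using xw(1,2) adjD[OF adj] by (auto simp: F_def)
  have "x = g" using adj gates by (cases rule: adj_cases) auto
  then obtain i where i: "i < length p" "x = p ! i" using g by (metis in_set_conv_nth)
  have edge: "{p ! k, p ! (Suc k mod length p)} \<in> E" if "k < length p" for k
    using that cycle_edges_E unfolding cycle_edges_def by blast
  \<comment> \<open>\<open>j\<close> and \<open>k\<close> are the positions after and before
    \<open>i\<close>; they differ because the cycle has at least three vertices.\<close>
  define j where "j = Suc i mod length p"
  define k where "k = (if i = 0 then length p - 1 else i - 1)"
  have j: "j < length p" "j \<noteq> i" using i length_p by (auto simp: j_def mod_Suc)
  have k: "k < length p" "k \<noteq> i" "Suc k mod length p = i" "k \<noteq> j"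
    using i length_p by (auto simp: k_def j_def mod_Suc)
  have "p ! j \<in> F" "p ! k \<in> F"
    using F_cycle j k i \<open>x = g\<close> distinct_p by (auto simp: nth_eq_iff_index_eq)
  moreover have "{x, p ! j} \<in> E" "{x, p ! k} \<in> E"
    using edge[OF i(1)] edge[OF k(1)] i k by (auto simp: j_def insert_commute)
  ultimately have "p ! j = p ! k" using xw(4) by metis
  then show False using j k distinct_p by (simp add: nth_eq_iff_index_eq)
qed

text \<open>Two gates of \<open>S\<close> and the vertex \<open>t\<close> doubly resolve the cycle,
  so an unresolved pair has a common gate \<open>g\<close>. The distance from a cycle vertex to
  \<open>g\<close> then cancels in the difference.\<close>

lemma vertex_fixing_difference_on_cycle:
  assumes S: "zero_forcing_set V E S"
  shows "\<exists>t\<in>V. \<forall>u\<in>V. \<forall>v\<in>V. (\<forall>s\<in>insert t S. d s u = d s v) \<longrightarrow>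
    (\<forall>x\<in>set p. \<forall>w\<in>set p. int (d x u) - int (d x v) = int (d w u) - int (d w v))"
proof -
  have SV: "S \<subseteq> V" using S by (simp add: zero_forcing_set_def)
  obtain s s' where s: "s \<in> S" "s' \<in> S" "gate s \<noteq> gate s'"
    using zero_forcing_set_gates[OF S] by blast
  obtain t where t: "t \<in> set p" and res: "\<And>a b k. \<lbrakk>a \<in> set p; b \<in> set p;
      \<And>z. z \<in> {gate s, gate s', t} \<Longrightarrow> int (d z a) - int (d z b) = k\<rbrakk> \<Longrightarrow> a = b"
    using third_doubly_resolving_vertex[of "gate s" "gate s'"] s gate SV by blast
  have "int (d x u) - int (d x v) = int (d w u) - int (d w v)"
    if uv: "u \<in> V" "v \<in> V" and eq: "\<forall>s\<in>insert t S. d s u = d s v" and xw: "x \<in> set p" "w \<in> set p"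
    for u v x w
  proof -
    have "gate u = gate v"
    proof (rule unresolved_same_gate[OF uv, of "insert t S" "{gate s, gate s', t}" "gate s" "gate s'"])
      show "insert t S \<subseteq> V" using t p_V SV by blast
      show "{gate s, gate s', t} \<subseteq> gate ` insert t S" using s gate_id[OF t] by force
    qed (use eq s res in auto)
    then show ?thesis using dist_from_cycle xw uv by simp
  qed
  then show ?thesis using t p_V by blast
qed

end


section \<open>The number of cycles of a cactus\<close>

text \<open>Take a maximal vertex set containing \<open>r\<close> that spans enough edges. If it is
  not all of \<open>V\<close>, some edge leaves it, and adding the outer end gains one vertex and at
  least one edge.\<close>

lemma card_le_Suc_card_edges:
  assumes "finite V" "finite F" "r \<in> V" "\<And>e. e \<in> F \<Longrightarrow> e \<subseteq> V"
    and reach: "\<And>v. v \<in> V \<Longrightarrow> (\<lambda>x y. {x, y} \<in> F)\<^sup>*\<^sup>* r v"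
  shows "card V \<le> card F + 1"
proof -
  let ?in = "\<lambda>A. {e \<in> F. e \<subseteq> A}"
  define \<A> where "\<A> = {A. r \<in> A \<and> A \<subseteq> V \<and> card A \<le> card (?in A) + 1}"
  have "finite \<A>" unfolding \<A>_def by (rule finite_subset[of _ "Pow V"]) (use assms in auto)
  moreover have "{r} \<in> \<A>" using assms by (simp add: \<A>_def)
  ultimately obtain A where "A \<in> \<A>" and max: "\<And>B. B \<in> \<A> \<Longrightarrow> A \<subseteq> B \<Longrightarrow> A = B"
    using finite_has_maximal[of \<A>] by blast
  then have A: "r \<in> A" "A \<subseteq> V" "card A \<le> card (?in A) + 1" by (auto simp: \<A>_def)
  have finA: "finite A" using A assms finite_subset by blast
  have "A = V"
  proof (rule ccontr)
    assume "A \<noteq> V"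
    then obtain v where v: "v \<in> V" "v \<notin> A" using A by blast
    have "\<exists>x y. {x, y} \<in> F \<and> x \<in> A \<and> y \<notin> A"
      using reach[OF v(1)] v(2) by (induction rule: rtranclp_induct) (use A in auto)
    then obtain x y where xy: "{x, y} \<in> F" "x \<in> A" "y \<notin> A" by blast
    have "y \<in> V" using assms(4)[OF xy(1)] by blast
    have "card (insert {x, y} (?in A)) \<le> card (?in (insert y A))"
      by (rule card_mono) (use xy assms(2) in auto)
    moreover have "card (insert {x, y} (?in A)) = Suc (card (?in A))"
      using xy assms(2) by (subst card_insert_disjoint) auto
    ultimately have "insert y A \<in> \<A>" using A finA xy \<open>y \<in> V\<close> by (simp add: \<A>_def)
    then show False using max[of "insert y A"] xy by blast
  qed
  moreover have "card (?in A) \<le> card F" using assms(2) by (intro card_mono) auto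
  ultimately show ?thesis using A by simp
qed

context connected_simple_graph
begin

definition cycles :: "'a set set set" where
  "cycles = cycle_edges ` {p. is_cycle V E p}"

lemma finite_cycles: "finite cycles"
  by (rule finite_subset[of _ "Pow E"]) (auto simp: cycles_def is_cycle_def finite_E)

text \<open>The deleted edges are the closing edges \<open>close C\<close>, distinct because cycles
  are edge disjoint. The rest of \<open>C\<close> avoids all deleted edges and still joins the ends
  of \<open>close C\<close>.\<close>

lemma card_cycles_le:
  assumes cactus: "cactus V E"
  shows "int (card cycles) \<le> cycle_rank V E"
proof -
  define rep where "rep C = (SOME p. is_cycle V E p \<and> cycle_edges p = C)" for C
  have rep: "is_cycle V E (rep C)" "cycle_edges (rep C) = C" if C: "C \<in> cycles" for C
  proof -
    have "\<exists>p. is_cycle V E p \<and> cycle_edges p = C" using C by (auto simp: cycles_def)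
    then have "is_cycle V E (rep C) \<and> cycle_edges (rep C) = C" unfolding rep_def by (rule someI_ex)
    then show "is_cycle V E (rep C)" "cycle_edges (rep C) = C" by auto
  qed
  have disjoint: "C = C'" if "C \<in> cycles" "C' \<in> cycles" "e \<in> C" "e \<in> C'" for C C' e
    using cactus_cycle_edges_eq[OF cactus] that unfolding cycles_def by blast
  define close where "close C = {last (rep C), hd (rep C)}" for C
  have rep_ne: "rep C \<noteq> []" if "C \<in> cycles" for C
    using rep[OF that] by (auto simp: is_cycle_def)
  have close: "close C \<in> C" if "C \<in> cycles" for C
    using rep[OF that] rep_ne[OF that] cycle_edges_conv[of "rep C"] unfolding close_def by blast
  have sub: "C \<subseteq> E" if "C \<in> cycles" for C
    using rep[OF that] by (auto simp: is_cycle_def)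
  have "inj_on close cycles" using close disjoint by (metis inj_onI)
  then have card_close: "card (close ` cycles) = card cycles" by (rule card_image)
  define F where "F = E - close ` cycles"
  let ?R = "\<lambda>x y. {x, y} \<in> F"
  have symR: "?R\<^sup>*\<^sup>* x y \<Longrightarrow> ?R\<^sup>*\<^sup>* y x" for x y
    by (rule rtranclp_sym) (auto simp: insert_commute)
  have around: "?R\<^sup>*\<^sup>* (hd (rep C)) (last (rep C))" if C: "C \<in> cycles" for C
  proof -
    let ?p = "rep C"
    have p: "3 \<le> length ?p" "distinct ?p" using rep[OF C] by (auto simp: is_cycle_def)
    have "successively ?R ?p"
      unfolding successively_conv_nth
    proof (intro allI impI)
      fix i assume i: "Suc i < length ?p"
      have inC: "{?p ! i, ?p ! Suc i} \<in> C"
        using cycle_edges_conv[OF rep_ne[OF C]] rep[OF C] i by blast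
      \<comment> \<open>Length at least 3 matters here: on two vertices the first edge would be the
        closing edge.\<close>
      have "{?p ! i, ?p ! Suc i} \<noteq> {?p ! (length ?p - 1), ?p ! 0}"
      proof -
        have "?p ! i \<noteq> ?p ! (length ?p - 1)"
          using nth_eq_iff_index_eq[OF p(2), of i "length ?p - 1"] i by auto
        moreover have "?p ! Suc i \<noteq> ?p ! (length ?p - 1)" if "?p ! i = ?p ! 0"
        proof -
          have "i = 0" using that nth_eq_iff_index_eq[OF p(2), of i 0] i rep_ne[OF C] by auto
          moreover have "1 < length ?p" "length ?p - 1 < length ?p" "1 \<noteq> length ?p - 1" using p(1) by auto
          ultimately show ?thesis using nth_eq_iff_index_eq[OF p(2), of 1 "length ?p - 1"] by simp
        qed
        ultimately show ?thesis by (auto simp: doubleton_eq_iff)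
      qed
      then have "{?p ! i, ?p ! Suc i} \<noteq> close C"
        using rep_ne[OF C] by (simp add: close_def last_conv_nth hd_conv_nth)
      then have "{?p ! i, ?p ! Suc i} \<notin> close ` cycles"
        using disjoint[OF C _ inC] close by (metis imageE)
      then show "{?p ! i, ?p ! Suc i} \<in> F" using inC sub[OF C] by (auto simp: F_def)
    qed
    then show ?thesis
      using rep_ne[OF C] successively_imp_relpowp[of ?R "hd ?p" "tl ?p"] relpowp_imp_rtranclp
      by fastforce
  qed
  have edge: "?R\<^sup>*\<^sup>* x y" if xy: "adj x y" for x y
  proof (cases "{x, y} \<in> F")
    case False
    then obtain C where C: "C \<in> cycles" "{x, y} = {last (rep C), hd (rep C)}"
      using xy by (auto simp: F_def adj_def close_def)
    then show ?thesis using around[OF C(1)] symR by (auto simp: doubleton_eq_iff)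
  qed blast
  obtain r where r: "r \<in> V" using conn by (auto simp: connected_graph_def)
  have "card V \<le> card F + 1"
  proof (rule card_le_Suc_card_edges[OF finite_V _ r])
    show "finite F" using finite_E by (simp add: F_def)
    show "e \<subseteq> V" if "e \<in> F" for e
      using that graph by (auto simp: F_def finite_simple_graph_def)
    show "?R\<^sup>*\<^sup>* r v" if "v \<in> V" for v
    proof -
      have "adj\<^sup>*\<^sup>* r v" using dist_walk[OF r that] by (rule relpowp_imp_rtranclp)
      then show ?thesis by (induction rule: rtranclp_induct) (auto intro: rtranclp_trans edge)
    qed
  qed
  moreover have "close ` cycles \<subseteq> E" using close sub by blast
  then have "card F = card E - card cycles" "card cycles \<le> card E"
    using card_close finite_E finite_cycles card_mono[of E "close ` cycles"]
    by (auto simp: F_def card_Diff_subset)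
  ultimately show ?thesis unfolding cycle_rank_def by linarith
qed


section \<open>A cycle from an unresolved pair\<close>

text \<open>The cycle consists of \<open>x\<close> and a path from \<open>w\<close> to a second
  neighbour \<open>x'\<close> of \<open>x\<close> that avoids \<open>x\<close>; the path is
  extracted from two geodesics to \<open>v\<close>.\<close>

lemma fort_edge_on_cycle:
  assumes uv: "u \<in> V" "v \<in> V" "u \<noteq> v" and xw: "adj x w" "d x u = d x v" "d w v < d w u"
    and only: "\<And>y. adj x y \<Longrightarrow> d y u \<noteq> d y v \<Longrightarrow> y = w"
  shows "\<exists>p. is_cycle V E p \<and> x \<in> set p \<and> w \<in> set p"
proof -
  have V: "x \<in> V" "w \<in> V" "x \<noteq> w" using xw adjD by blast+
  have "x \<noteq> u" using uv xw(2) V dist_refl dist_eq_0_iff by metis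
  then obtain x' where x': "adj x x'" "d x u = Suc (d x' u)" using dist_step V uv by blast
  \<comment> \<open>Otherwise \<open>d w u\<close> would be \<open>d x v - 1\<close>, which is at
    most \<open>d w v\<close>.\<close>
  have "x' \<noteq> w" using x' xw dist_adj_le[of x w v] uv by auto
  then have "d x' u = d x' v" using only x'(1) by blast
  then have x'v: "d x' v < d x v" using x'(2) xw(2) by simp
  define B where "B y z \<longleftrightarrow> adj y z \<and> y \<noteq> x \<and> z \<noteq> x" for y z
  have symB: "B\<^sup>*\<^sup>* y z \<Longrightarrow> B\<^sup>*\<^sup>* z y" for y z
    by (rule rtranclp_sym) (auto simp: B_def adj_sym)
  \<comment> \<open>On a geodesic to \<open>v\<close> the distance to \<open>v\<close> stays below
    \<open>d x v\<close>, so \<open>x\<close> is never met.\<close>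
  have from_x': "B\<^sup>*\<^sup>* y v" if "y \<in> V" "d y v < d x v" for y
    using that
  proof (induction "d y v" arbitrary: y)
    case 0
    then show ?case using dist_eq_0_iff uv by auto
  next
    case (Suc k)
    then have "y \<noteq> v" using uv by auto
    then obtain z where z: "adj y z" "d y v = Suc (d z v)" using dist_step Suc.prems uv by blast
    then have "B y z" using Suc.prems by (auto simp: B_def)
    moreover have "B\<^sup>*\<^sup>* z v" using Suc.hyps(1)[of z] Suc.hyps(2) Suc.prems z adjD(2)[OF z(1)] by simp
    ultimately show ?case by (rule converse_rtranclp_into_rtranclp)
  qed
  \<comment> \<open>Being closer to \<open>v\<close> than to \<open>u\<close> persists along a
    geodesic to \<open>v\<close>, and \<open>x\<close> is equally far from both.\<close>
  have from_w: "B\<^sup>*\<^sup>* y v" if "y \<in> V" "d y v < d y u" for y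
    using that
  proof (induction "d y v" arbitrary: y)
    case 0
    then show ?case using dist_eq_0_iff uv by auto
  next
    case (Suc k)
    then have "y \<noteq> v" using uv by auto
    then obtain z where z: "adj y z" "d y v = Suc (d z v)" using dist_step Suc.prems uv by blast
    then have z': "d z v < d z u" using Suc.prems dist_adj_le[OF z(1) uv(1)] by simp
    then have "B y z" using Suc.prems z xw(2) by (auto simp: B_def)
    moreover have "B\<^sup>*\<^sup>* z v" using Suc.hyps(1)[of z] Suc.hyps(2) z z' adjD(2)[OF z(1)] by simp
    ultimately show ?case by (rule converse_rtranclp_into_rtranclp)
  qed
  have "B\<^sup>*\<^sup>* w x'"
    using from_w[of w] from_x'[of x'] symB V x' x'v xw adjD(2) by (meson rtranclp_trans)
  then obtain xs where xs: "successively B xs" "distinct xs" "xs \<noteq> []" "hd xs = w" "last xs = x'"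
    using rtranclp_imp_distinct_successively by metis
  obtain zs where zs: "xs = w # zs" using xs by (cases xs) auto
  have "x \<notin> set zs \<and> set zs \<subseteq> V"
  proof -
    have "x \<notin> set zs \<and> set zs \<subseteq> V" if "successively B (y # zs)" for y zs
      using that by (induction zs arbitrary: y) (auto simp: B_def dest: adjD)
    from this[of w zs] show ?thesis using xs(1) zs by simp
  qed
  moreover have "zs \<noteq> []" using xs zs \<open>x' \<noteq> w\<close> by auto
  moreover have "cycle_edges (x # xs) \<subseteq> E"
  proof (rule cycle_edges_subsetI)
    have "successively (\<lambda>x y. {x, y} \<in> E) xs"
      using xs(1) by (rule successively_mono) (auto simp: B_def adj_def)
    then show "successively (\<lambda>x y. {x, y} \<in> E) (x # xs)" using xw zs by (simp add: adj_def)
    show "{last (x # xs), hd (x # xs)} \<in> E" using xs x' by (simp add: adj_def insert_commute)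
  qed simp
  ultimately have "is_cycle V E (x # xs)"
    using xs zs V by (cases zs) (auto simp: is_cycle_def)
  then show ?thesis using zs by (intro exI[of _ "x # xs"]) simp
qed

section \<open>Assembling the resolving set\<close>

lemma resolving_set_from_zero_forcing_set:
  assumes cactus: "cactus V E" and S: "zero_forcing_set V E S"
  obtains T where "resolving_set V E (S \<union> T)" "card T \<le> card cycles"
proof -
  have SV: "S \<subseteq> V" using S by (simp add: zero_forcing_set_def)
  \<comment> \<open>Phrased for the edge set \<open>C\<close>, so that one vertex is chosen per
    cycle and not per vertex list.\<close>
  let ?good = "\<lambda>C t. t \<in> V \<and> (\<forall>u\<in>V. \<forall>v\<in>V. (\<forall>s\<in>insert t S. d s u = d s v) \<longrightarrow>
    (\<forall>x\<in>\<Union>C. \<forall>w\<in>\<Union>C. int (d x u) - int (d x v) = int (d w u) - int (d w v)))"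
  have "\<forall>C\<in>cycles. \<exists>t. ?good C t"
  proof
    fix C assume "C \<in> cycles"
    then obtain p where p: "is_cycle V E p" "C = cycle_edges p" by (auto simp: cycles_def)
    interpret cactus_cycle V E p using cactus p by unfold_locales
    show "\<exists>t. ?good C t"
      using vertex_fixing_difference_on_cycle[OF S] unfolding p(2) Union_cycle_edges by blast
  qed
  then obtain t where t: "\<And>C. C \<in> cycles \<Longrightarrow> ?good C (t C)" by metis
  show ?thesis
  proof
    show "card (t ` cycles) \<le> card cycles"
      using finite_cycles by (rule card_image_le)
    show "resolving_set V E (S \<union> t ` cycles)"
      unfolding resolving_set_def
    proof (intro conjI ballI impI)
      show "S \<union> t ` cycles \<subseteq> V" using SV t by blast
      fix u v assume uv: "u \<in> V" "v \<in> V" "u \<noteq> v"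
      show "\<exists>s\<in>S \<union> t ` cycles. d s u \<noteq> d s v"
      proof (rule ccontr)
        assume "\<not> ?thesis"
        then have unres: "\<And>s. s \<in> S \<union> t ` cycles \<Longrightarrow> d s u = d s v" by blast
        have const: "int (d x u) - int (d x v) = int (d w u) - int (d w v)"
          if p: "is_cycle V E p" "x \<in> set p" "w \<in> set p" for p x w
        proof -
          have C: "cycle_edges p \<in> cycles" using p by (simp add: cycles_def)
          have "\<forall>s\<in>insert (t (cycle_edges p)) S. d s u = d s v" using unres C by blast
          then show ?thesis using t[OF C] uv p unfolding Union_cycle_edges by blast
        qed
        define F where "F = {x \<in> V. d x u \<noteq> d x v}"
        have "u \<in> F" using uv dist_eq_0_iff[of u v] by (auto simp: F_def)
        then have "F \<noteq> {}" by blast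
        moreover have "F \<subseteq> V" "S \<inter> F = {}" using unres by (auto simp: F_def)
        ultimately obtain x w where xw: "x \<notin> F" "w \<in> F" "{x, w} \<in> E"
          and only: "\<forall>y\<in>F. {x, y} \<in> E \<longrightarrow> y = w" using zero_forcing_fort[OF S] by blast
        have adj: "adj x w" using xw by (simp add: adj_def)
        have x: "d x u = d x v" and w: "d w u \<noteq> d w v" using xw adjD[OF adj] by (auto simp: F_def)
        have only': "y = w" if "adj x y" "d y u \<noteq> d y v" for y
          using only that adjD(2)[OF that(1)] by (auto simp: F_def adj_def)
        have "\<exists>p. is_cycle V E p \<and> x \<in> set p \<and> w \<in> set p"
        proof (cases "d w v < d w u")
          case True
          then show ?thesis using fort_edge_on_cycle[OF uv adj x _ only'] by blast
        next
          \<comment> \<open>The opposite sign is the same situation with \<open>u\<close> and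
            \<open>v\<close> exchanged.\<close>
          case False
          then have "d w u < d w v" using w by simp
          then show ?thesis
            using fort_edge_on_cycle[OF uv(2,1) uv(3)[symmetric] adj x[symmetric]] only' by metis
        qed
        then show False using const[of _ x w] x w by force
      qed
    qed
  qed
qed

end

theorem theorem3:
  fixes V :: "'a set" and E :: "'a set set"
  assumes "finite_simple_graph V E"
    and "connected_graph V E"
    and "cactus V E"
  shows "int (metric_dimension V E) \<le> cycle_rank V E + int (zero_forcing_number V E)"
proof -
  interpret connected_simple_graph V E using assms by unfold_locales
  \<comment> \<open>Some zero forcing set exists, so the minimum in
    \<open>zero_forcing_number\<close> is attained.\<close>
  have "zero_forcing_set V E V" by (simp add: zero_forcing_set_def)
  then have "\<exists>k S. zero_forcing_set V E S \<and> card S = k" by blast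
  from LeastI_ex[OF this] have "\<exists>S. zero_forcing_set V E S \<and> card S = zero_forcing_number V E"
    unfolding zero_forcing_number_def .
  then obtain S where S: "zero_forcing_set V E S" "card S = zero_forcing_number V E" by blast
  obtain T where T: "resolving_set V E (S \<union> T)" "card T \<le> card cycles"
    using resolving_set_from_zero_forcing_set[OF assms(3) S(1)] by blast
  have "metric_dimension V E \<le> card (S \<union> T)"
    unfolding metric_dimension_def by (rule Least_le) (use T(1) in blast)
  also have "\<dots> \<le> zero_forcing_number V E + card cycles"
    using card_Un_le[of S T] T(2) S(2) by simp
  finally show ?thesis using card_cycles_le[OF assms(3)] by linarith
qed

end
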